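(* Let $v(x,y)$ be the analytic function represented, in a sufficiently small neighborhood of $(0,0)$, by the power series $\sum_{p,q\ge0}\alpha_{p,q}\,x^q\frac{y^p}{p!}$. Let $(r,s)$ be variables related to $(x,y)$ by $$x(r,s)=\frac{r}{rs+1},\qquad y(r,s)=\frac{rs^2-2rs+2s}{2(rs+1)}.$$ Then, for $(r,s)$ near $(0,0)$, $$v\big(x(r,s),y(r,s)\big)=\frac{e^{s}(rs+1)}{1-r}.$$
   Context: Let $p,q\ge 0$ be integers and $n=p+q$. A signed $(p,q)$-involution is an involution $\pi$ of $\{1,\dots,n\}$ together with an assignment of a sign $+$ or $-$ to each fixed point of $\pi$, such that (number of $+$ signs) $-$ (number of $-$ signs) $=p-q$. $\alpha_{p,q}$ is the number of signed $(p,q)$-involutions; in particular $\alpha_{p,0}=\alpha_{0,q}=1$. *)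

theory Defs
  imports "HOL-Analysis.Analysis" "HOL-Combinatorics.Permutations"
begin

datatype sign = Plus | Minus

definition fixed_points :: "nat \<Rightarrow> (nat \<Rightarrow> nat) \<Rightarrow> nat set" where
  "fixed_points n \<pi> = {i \<in> {1..n}. \<pi> i = i}"

(* The permutation is the identity outside {1..n}, and the sign assignment is
   extensional (undefined off the fixed points), so that equality of pairs is
   equality of signed involutions. The identity counts as an involution. *)
definition signed_involutions :: "nat \<Rightarrow> nat \<Rightarrow> ((nat \<Rightarrow> nat) \<times> (nat \<Rightarrow> sign)) set" where
  "signed_involutions p q =
     {(\<pi>, \<sigma>). \<pi> permutes {1..p + q} \<and> \<pi> \<circ> \<pi> = id \<and>
        \<sigma> \<in> fixed_points (p + q) \<pi> \<rightarrow>\<^sub>E UNIV \<and>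
        int (card {i \<in> fixed_points (p + q) \<pi>. \<sigma> i = Plus})
          - int (card {i \<in> fixed_points (p + q) \<pi>. \<sigma> i = Minus}) = int p - int q}"

definition alpha :: "nat \<Rightarrow> nat \<Rightarrow> nat" where
  "alpha p q = card (signed_involutions p q)"

lemma finite_signed_involutions: "finite (signed_involutions p q)"
proof -
  have "finite (fixed_points (p + q) \<pi> \<rightarrow>\<^sub>E (UNIV :: sign set))" for \<pi>
  proof (rule finite_PiE)
    show "finite (UNIV :: sign set)"
      by (rule finite_subset[of _ "{Plus, Minus}"]) (use sign.exhaust in auto)
  qed (auto simp: fixed_points_def)
  then have "finite (SIGMA \<pi>:{\<pi>. \<pi> permutes {1..p + q}}. fixed_points (p + q) \<pi> \<rightarrow>\<^sub>E (UNIV :: sign set))"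
    by (intro finite_SigmaI finite_permutations) auto
  then show ?thesis
    by (rule finite_subset[rotated]) (auto simp: signed_involutions_def)
qed

(* Term of the double series at index (p, q): p is the exponent of y, q that of x. *)
definition v_term :: "complex \<Rightarrow> complex \<Rightarrow> nat \<times> nat \<Rightarrow> complex" where
  "v_term x y = (\<lambda>(p, q). of_nat (alpha p q) * x ^ q * (y ^ p / fact p))"

definition v :: "complex \<Rightarrow> complex \<Rightarrow> complex" where
  "v x y = infsum (v_term x y) UNIV"

definition x_coord :: "complex \<Rightarrow> complex \<Rightarrow> complex" where
  "x_coord r s = r / (r * s + 1)"

definition y_coord :: "complex \<Rightarrow> complex \<Rightarrow> complex" where
  "y_coord r s = (r * s\<^sup>2 - 2 * r * s + 2 * s) / (2 * (r * s + 1))"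

end

theory Submission
  imports Defs
begin

text \<open>
  Removing the largest element of a signed involution (a fixed point of either sign, or a point
  matched with some \<open>j\<close>) gives
  \<open>\<alpha>(p,q) = \<alpha>(p-1,q) + \<alpha>(p,q-1) + (p+q-1) \<alpha>(p-1,q-1)\<close>, hence
  \<open>\<alpha>(p,q) = (p+q)! \<Sum>k. 1 / (2^k k! (p-k)! (q-k)!)\<close>. With \<open>p = a+k\<close> and \<open>q = b+k\<close>, the series becomes a
  triple series that is summed in turn over \<open>b\<close> (negative binomial series), over \<open>k\<close> by
  \<open>\<Sum>k. (a+2k choose k) (z(1-z))^k = 1 / ((1-z)^a (1-2z))\<close>, and over \<open>a\<close> (exponential series).
  The substitution in \<open>r, s\<close> uniformizes the square root hidden in the middle step:
  \<open>z(1-z) = xy / (2(1-x)\<^sup>2)\<close> has the rational solution \<open>z = rs / (2(1+rs-r))\<close>.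
\<close>

subsection \<open>Counting signed involutions\<close>

fun sign_val :: "sign \<Rightarrow> int" where
  "sign_val Plus = 1"
| "sign_val Minus = -1"

text \<open>Arbitrary carriers \<open>A\<close> keep the family closed under deleting a matched
  pair, which leaves a gap in an initial segment. The excess \<open>d\<close> of plus over minus
  signs shifts by one when a fixed point is deleted.\<close>

definition weighted_involutions :: "nat set \<Rightarrow> int \<Rightarrow> ((nat \<Rightarrow> nat) \<times> (nat \<Rightarrow> sign)) set" where
  "weighted_involutions A d =
     {(\<pi>, \<sigma>). \<pi> permutes A \<and> \<pi> \<circ> \<pi> = id \<and> \<sigma> \<in> {i \<in> A. \<pi> i = i} \<rightarrow>\<^sub>E UNIV \<and>
        (\<Sum>i \<in> {i \<in> A. \<pi> i = i}. sign_val (\<sigma> i)) = d}"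

lemma sum_sign_val:
  assumes "finite F"
  shows "(\<Sum>i\<in>F. sign_val (\<sigma> i)) = int (card {i \<in> F. \<sigma> i = Plus}) - int (card {i \<in> F. \<sigma> i = Minus})"
proof -
  have "sign_val s = (if s = Plus then 1 else 0) - (if s = Minus then 1 else 0)" for s
    by (cases s) auto
  then have "(\<Sum>i\<in>F. sign_val (\<sigma> i)) =
      (\<Sum>i\<in>F. if \<sigma> i = Plus then 1 else 0) - (\<Sum>i\<in>F. if \<sigma> i = Minus then 1 else 0)"
    by (simp add: sum_subtractf)
  then show ?thesis
    using assms by (simp add: sum.If_cases Int_def)
qed

lemma signed_involutions_eq: "signed_involutions p q = weighted_involutions {1..p + q} (int p - int q)"
  unfolding signed_involutions_def weighted_involutions_def fixed_points_def
  by (simp add: sum_sign_val)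

lemma finite_weighted_involutions:
  assumes "finite A"
  shows "finite (weighted_involutions A d)"
proof -
  have "finite (UNIV :: sign set)"
    by (rule finite_subset[of _ "{Plus, Minus}"]) (use sign.exhaust in auto)
  then have "finite (SIGMA \<pi>:{\<pi>. \<pi> permutes A}. {i \<in> A. \<pi> i = i} \<rightarrow>\<^sub>E (UNIV :: sign set))"
    using assms by (intro finite_SigmaI finite_permutations finite_PiE) auto
  then show ?thesis
    by (rule finite_subset[rotated]) (auto simp: weighted_involutions_def)
qed

lemma weighted_involutions_empty:
  "weighted_involutions {} d = (if d = 0 then {(id, \<lambda>_. undefined)} else {})"
  by (auto simp: weighted_involutions_def)

text \<open>There are at most \<open>card A\<close> fixed points, each contributing absolute value
  one. This kills the terms of the recurrence that would call for a negative \<open>p\<close> or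
  \<open>q\<close>.\<close>

lemma weighted_involutions_eq_empty:
  assumes "finite A" "\<bar>d\<bar> > int (card A)"
  shows "weighted_involutions A d = {}"
proof -
  have "\<bar>\<Sum>i \<in> {i \<in> A. \<pi> i = i}. sign_val (\<sigma> i)\<bar> \<le> int (card A)" for \<pi> :: "nat \<Rightarrow> nat" and \<sigma>
  proof -
    have "\<bar>sign_val s\<bar> = 1" for s by (cases s) auto
    then have "\<bar>\<Sum>i \<in> {i \<in> A. \<pi> i = i}. sign_val (\<sigma> i)\<bar> \<le> (\<Sum>i \<in> {i \<in> A. \<pi> i = i}. 1)"
      by (metis (no_types, lifting) sum_abs sum.cong)
    also have "\<dots> \<le> int (card A)"
      using assms by (auto intro: card_mono)
    finally show ?thesis .
  qed
  with assms show ?thesis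
    unfolding weighted_involutions_def by (auto simp: not_le[symmetric])
qed

section \<open>Deleting one point of a signed involution\<close>

text \<open>Forgetting the sign at \<open>x\<close> is undone by writing \<open>e\<close> back,
  since \<open>e\<close> is prescribed. The sign is reset to \<open>undefined\<close> so that the
  assignment stays extensional on the smaller set.\<close>

lemma card_weighted_involutions_fixed:
  assumes "finite A" "x \<notin> A"
  shows "card {(\<pi>, \<sigma>) \<in> weighted_involutions (insert x A) d. \<pi> x = x \<and> \<sigma> x = e}
       = card (weighted_involutions A (d - sign_val e))" (is "card ?L = card ?R")
proof -
  have fx: "{i \<in> insert x A. \<pi> i = i} = insert x {i \<in> A. \<pi> i = i}" if "\<pi> x = x" for \<pi> :: "nat \<Rightarrow> nat"
    using that by auto
  have sm: "(\<Sum>i \<in> insert x {i \<in> A. \<pi> i = i}. sign_val (\<sigma> i)) =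
      sign_val (\<sigma> x) + (\<Sum>i \<in> {i \<in> A. \<pi> i = i}. sign_val (\<sigma> i))" for \<pi> \<sigma>
    using assms by (subst sum.insert) auto
  have upd: "(\<Sum>i \<in> {i \<in> A. \<pi> i = i}. sign_val ((\<sigma>(x := s)) i)) =
      (\<Sum>i \<in> {i \<in> A. \<pi> i = i}. sign_val (\<sigma> i))" for \<pi> \<sigma> s
    using assms by (intro sum.cong) auto
  have perm: "\<pi> permutes insert x A \<and> \<pi> x = x \<longleftrightarrow> \<pi> permutes A" for \<pi>
    using assms permutes_superset[of \<pi> "insert x A" A] permutes_subset[of \<pi> A "insert x A"]
      permutes_not_in[of \<pi> A x] by auto
  have "bij_betw (\<lambda>(\<pi>, \<sigma>). (\<pi>, \<sigma>(x := undefined))) ?L ?R"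
  proof (rule bij_betw_byWitness[where f' = "\<lambda>(\<pi>, \<sigma>). (\<pi>, \<sigma>(x := e))"])
    show "(\<lambda>(\<pi>, \<sigma>). (\<pi>, \<sigma>(x := undefined))) ` ?L \<subseteq> ?R"
    proof clarify
      fix \<pi> \<sigma> assume *: "(\<pi>, \<sigma>) \<in> weighted_involutions (insert x A) d" "\<pi> x = x" "e = \<sigma> x"
      let ?F = "{i \<in> A. \<pi> i = i}"
      have "\<pi> permutes insert x A" and i: "\<pi> \<circ> \<pi> = id" and s: "\<sigma> \<in> insert x ?F \<rightarrow>\<^sub>E UNIV"
        "(\<Sum>i \<in> insert x ?F. sign_val (\<sigma> i)) = d"
        using *(1) unfolding weighted_involutions_def mem_Collect_eq prod.case fx[of \<pi>, OF *(2)] by blast+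
      then have p: "\<pi> permutes A" using perm *(2) by blast
      have "\<sigma>(x := undefined) \<in> ?F \<rightarrow>\<^sub>E UNIV"
        using s(1) by (auto simp: PiE_iff extensional_def)
      then show "(\<pi>, \<sigma>(x := undefined)) \<in> weighted_involutions A (d - sign_val (\<sigma> x))"
        using p i s(2) unfolding weighted_involutions_def mem_Collect_eq prod.case upd sm by simp
    qed
    show "(\<lambda>(\<pi>, \<sigma>). (\<pi>, \<sigma>(x := e))) ` ?R \<subseteq> ?L"
    proof clarify
      fix \<pi> \<sigma> assume *: "(\<pi>, \<sigma>) \<in> weighted_involutions A (d - sign_val e)"
      let ?F = "{i \<in> A. \<pi> i = i}"
      have p: "\<pi> permutes A" and i: "\<pi> \<circ> \<pi> = id" and s: "\<sigma> \<in> ?F \<rightarrow>\<^sub>E UNIV"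
        "(\<Sum>i \<in> ?F. sign_val (\<sigma> i)) = d - sign_val e"
        using * unfolding weighted_involutions_def by blast+
      have p': "\<pi> permutes insert x A" and px: "\<pi> x = x" using perm p by blast+
      have "\<sigma>(x := e) \<in> insert x ?F \<rightarrow>\<^sub>E UNIV"
        using s(1) by (auto simp: PiE_iff extensional_def)
      then show "(\<pi>, \<sigma>(x := e)) \<in> weighted_involutions (insert x A) d \<and> \<pi> x = x \<and> (\<sigma>(x := e)) x = e"
        using p' i px s(2) unfolding weighted_involutions_def mem_Collect_eq prod.case fx[of \<pi>, OF px] sm upd by simp
    qed
    show "\<forall>a\<in>?L. (\<lambda>(\<pi>, \<sigma>). (\<pi>, \<sigma>(x := e))) ((\<lambda>(\<pi>, \<sigma>). (\<pi>, \<sigma>(x := undefined))) a) = a"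
      by auto
    show "\<forall>a\<in>?R. (\<lambda>(\<pi>, \<sigma>). (\<pi>, \<sigma>(x := undefined))) ((\<lambda>(\<pi>, \<sigma>). (\<pi>, \<sigma>(x := e))) a) = a"
      using assms by (auto simp: weighted_involutions_def fun_eq_iff PiE_iff extensional_def)
  qed
  then show ?thesis
    by (rule bij_betw_same_card)
qed

text \<open>The transposition of two fixed points of \<pi> commutes with \<pi>, and both square to
  the identity.\<close>

lemma involution_transpose_comp:
  assumes "\<pi> \<circ> \<pi> = id" "\<pi> x = x" "\<pi> j = j"
  shows "(Transposition.transpose x j \<circ> \<pi>) \<circ> (Transposition.transpose x j \<circ> \<pi>) = id"
proof
  fix i
  have inv: "\<pi> (\<pi> i) = i" for i
    using assms(1) by (simp add: fun_eq_iff)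
  show "((Transposition.transpose x j \<circ> \<pi>) \<circ> (Transposition.transpose x j \<circ> \<pi>)) i = id i"
    using assms(2,3) inv[of i] by (cases "\<pi> i = x"; cases "\<pi> i = j") (auto simp: Transposition.transpose_def)
qed

text \<open>Composing with the transposition of \<open>x\<close> and \<open>j\<close> undoes the
  matching of these two points and, being its own inverse, also restores it. The signs are carried
  along unchanged.\<close>

lemma card_weighted_involutions_swapped:
  assumes "x \<notin> A" "j \<in> A"
  shows "card {(\<pi>, \<sigma>) \<in> weighted_involutions (insert x A) d. \<pi> x = j}
       = card (weighted_involutions (A - {j}) d)" (is "card ?L = card ?R")
proof -
  let ?f = "\<lambda>(\<pi>, \<sigma> :: nat \<Rightarrow> sign). (Transposition.transpose x j \<circ> \<pi>, \<sigma>)"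
  have ne: "x \<noteq> j" using assms by auto
  have "bij_betw ?f ?L ?R"
  proof (rule bij_betw_byWitness[where f' = ?f])
    show "?f ` ?L \<subseteq> ?R"
    proof clarify
      fix \<pi> \<sigma> assume *: "(\<pi>, \<sigma>) \<in> weighted_involutions (insert x A) d" "j = \<pi> x"
      define \<rho> where "\<rho> = Transposition.transpose x j \<circ> \<pi>"
      have p: "\<pi> permutes insert x A" and i: "\<pi> \<circ> \<pi> = id"
        using * by (auto simp: weighted_involutions_def)
      have i': "\<pi> (\<pi> k) = k" for k using i by (simp add: fun_eq_iff)
      have px: "\<pi> x = j" "\<pi> j = x" using * i'[of x] by auto
      have r: "\<rho> x = x" "\<rho> j = j"
        unfolding \<rho>_def using px by auto
      have o: "\<pi> k \<noteq> x" "\<pi> k \<noteq> j" if "k \<noteq> x" "k \<noteq> j" for k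
        using i'[of k] px that by metis+
      then have ro: "\<rho> k = \<pi> k" if "k \<noteq> x" "k \<noteq> j" for k
        unfolding \<rho>_def using that by (simp add: transpose_apply_other)
      have "\<rho> permutes insert x A"
        unfolding \<rho>_def using p assms by (intro permutes_compose permutes_swap_id) auto
      then have "\<rho> permutes A - {j}"
        by (rule permutes_superset) (use r in auto)
      moreover have "\<rho> (\<rho> k) = k" for k
        using r ro[of k] o[of k] ro[of "\<pi> k"] i'[of k] by (cases "k = x \<or> k = j") auto
      then have "\<rho> \<circ> \<rho> = id" by (simp add: fun_eq_iff)
      \<comment> \<open>The points \<open>x\<close> and \<open>j\<close> are moved by \<pi> and lie
        outside the smaller carrier, so both sides have the same fixed points and \<sigma> needs no
        change.\<close>
      moreover have "i \<in> insert x A \<and> \<pi> i = i \<longleftrightarrow> i \<in> A - {j} \<and> \<rho> i = i" for i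
        using ro[of i] px ne assms by (cases "i = x \<or> i = j") auto
      then have "{i \<in> insert x A. \<pi> i = i} = {i \<in> A - {j}. \<rho> i = i}" by blast
      ultimately show "(Transposition.transpose x (\<pi> x) \<circ> \<pi>, \<sigma>) \<in> weighted_involutions (A - {\<pi> x}) d"
        using * unfolding \<rho>_def weighted_involutions_def by auto
    qed
    show "?f ` ?R \<subseteq> ?L"
    proof clarify
      fix \<pi> \<sigma> assume *: "(\<pi>, \<sigma>) \<in> weighted_involutions (A - {j}) d"
      define \<rho> where "\<rho> = Transposition.transpose x j \<circ> \<pi>"
      have p: "\<pi> permutes A - {j}" and i: "\<pi> \<circ> \<pi> = id"
        using * by (auto simp: weighted_involutions_def)
      have px: "\<pi> x = x" "\<pi> j = j" using p assms by (auto simp: permutes_def)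
      have r: "\<rho> x = j" "\<rho> j = x"
        unfolding \<rho>_def using px by auto
      have i': "\<pi> (\<pi> k) = k" for k using i by (simp add: fun_eq_iff)
      have ro: "\<rho> k = \<pi> k" if "k \<noteq> x" "k \<noteq> j" for k
        unfolding \<rho>_def using i'[of k] px that by (metis comp_apply transpose_apply_other)
      have "\<pi> permutes insert x A"
        using p by (rule permutes_subset) auto
      then have "\<rho> permutes insert x A"
        unfolding \<rho>_def using assms by (intro permutes_compose permutes_swap_id) auto
      moreover have "\<rho> \<circ> \<rho> = id"
        unfolding \<rho>_def using i px by (rule involution_transpose_comp)
      moreover have "i \<in> insert x A \<and> \<rho> i = i \<longleftrightarrow> i \<in> A - {j} \<and> \<pi> i = i" for i
        using ro[of i] r ne assms by (cases "i = x \<or> i = j") auto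
      then have "{i \<in> insert x A. \<rho> i = i} = {i \<in> A - {j}. \<pi> i = i}" by blast
      ultimately show "(Transposition.transpose x j \<circ> \<pi>, \<sigma>) \<in> weighted_involutions (insert x A) d \<and>
          (Transposition.transpose x j \<circ> \<pi>) x = j"
        using * r unfolding \<rho>_def weighted_involutions_def by auto
    qed
    show "\<forall>a\<in>?L. ?f (?f a) = a" "\<forall>a\<in>?R. ?f (?f a) = a"
      by (auto simp: fun_eq_iff)
  qed
  then show ?thesis
    by (rule bij_betw_same_card)
qed

text \<open>The point \<open>x\<close> is a plus fixed point, a minus fixed point, or matched with
  exactly one \<open>j\<close> in \<open>A\<close>. These classes are disjoint, and the two
  preceding bijections count them.\<close>

lemma card_weighted_involutions_insert:
  assumes "finite A" "x \<notin> A"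
  shows "card (weighted_involutions (insert x A) d) =
    card (weighted_involutions A (d - 1)) + card (weighted_involutions A (d + 1)) +
    (\<Sum>j\<in>A. card (weighted_involutions (A - {j}) d))"
proof -
  let ?W = "weighted_involutions (insert x A) d"
  let ?F = "\<lambda>e. {(\<pi>, \<sigma>) \<in> ?W. \<pi> x = x \<and> \<sigma> x = e}"
  let ?S = "\<lambda>j. {(\<pi>, \<sigma>) \<in> ?W. \<pi> x = j}"
  have fin: "finite ?W"
    using assms by (simp add: finite_weighted_involutions)
  then have finF: "finite (?F e)" and finS: "finite (?S j)" for e j
    by (auto elim: finite_subset[rotated])
  have mem: "\<pi> x = x \<or> \<pi> x \<in> A" if "(\<pi>, \<sigma>) \<in> ?W" for \<pi> \<sigma>
    using that permutes_in_image[of \<pi> "insert x A" x] by (auto simp: weighted_involutions_def)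
  have W: "?W = (?F Plus \<union> ?F Minus) \<union> (\<Union>j\<in>A. ?S j)"
    using mem by (auto intro: sign.exhaust)
  have "card ?W = card ((?F Plus \<union> ?F Minus) \<union> (\<Union>j\<in>A. ?S j))"
    using W by simp
  also have "\<dots> = card (?F Plus \<union> ?F Minus) + card (\<Union>j\<in>A. ?S j)"
    using finF finS assms by (intro card_Un_disjoint) auto
  also have "card (?F Plus \<union> ?F Minus) = card (?F Plus) + card (?F Minus)"
    using finF by (intro card_Un_disjoint) auto
  also have "card (\<Union>j\<in>A. ?S j) = (\<Sum>j\<in>A. card (?S j))"
    using finS assms by (intro card_UN_disjoint) auto
  finally show ?thesis
    using assms by (simp add: card_weighted_involutions_fixed card_weighted_involutions_swapped)
qed

section \<open>Closed formula for the counts\<close>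

text \<open>
  The term of \<open>\<alpha>(p,q) / (p+q)!\<close> contributed by involutions with exactly \<open>k\<close> transpositions.
\<close>

definition inv_coeff :: "nat \<Rightarrow> nat \<Rightarrow> nat \<Rightarrow> real" where
  "inv_coeff p q k = (if k \<le> p \<and> k \<le> q then 1 / (2 ^ k * fact k * fact (p - k) * fact (q - k)) else 0)"

text \<open>The coefficients vanish beyond \<open>min p q\<close>, so sums with different upper
  limits can be brought to a common range.\<close>

lemma sum_inv_coeff:
  assumes "min p q \<le> m"
  shows "(\<Sum>k\<le>m. inv_coeff p q k) = (\<Sum>k\<le>min p q. inv_coeff p q k)"
  using assms by (intro sum.mono_neutral_right) (auto simp: inv_coeff_def)

lemma inv_coeff_Suc_left: "(1 + real p - real k) * inv_coeff (Suc p) q k = inv_coeff p q k"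
proof (cases "k \<le> p")
  case True
  then have "(fact (Suc p - k) :: real) = (1 + real p - real k) * fact (p - k)"
    by (simp add: Suc_diff_le of_nat_diff)
  moreover have "1 + real p - real k \<noteq> 0" using True by linarith
  ultimately show ?thesis
    using True by (auto simp: inv_coeff_def)
next
  case False
  \<comment> \<open>At \<open>k = Suc p\<close> the prefactor is zero while the coefficient may not
    be; beyond that, both coefficients are zero.\<close>
  then show ?thesis by (cases "k = Suc p") (auto simp: inv_coeff_def)
qed

lemma inv_coeff_commute: "inv_coeff p q k = inv_coeff q p k"
  by (simp add: inv_coeff_def mult_ac)

lemma inv_coeff_Suc_Suc: "2 * (1 + real k) * inv_coeff (Suc p) (Suc q) (Suc k) = inv_coeff p q k"
proof -
  have *: "2 * c * (1 / ((2 * P) * (c * F) * A * B)) = 1 / (P * F * A * B)" if "c \<noteq> 0" for c P F A B :: real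
    using that by simp
  have "1 + real k \<noteq> 0"
    by linarith
  then show ?thesis
    using *[of "1 + real k" "2 ^ k" "fact k" "fact (p - k)" "fact (q - k)"]
    by (cases "k \<le> p \<and> k \<le> q") (simp_all only: inv_coeff_def Suc_le_mono diff_Suc_Suc power_Suc
        fact_Suc of_nat_Suc if_True if_False simp_thms mult_zero_right)
qed

text \<open>Split \<open>p + q + 2\<close> as \<open>(p + 1 - k) + (q + 1 - k) + 2 * k\<close>: plus
  points, minus points and matched points of an involution with \<open>k\<close> transpositions.
  Each factor cancels against a factorial and lowers the matching indices.\<close>

lemma sum_inv_coeff_Suc:
  "(real p + real q + 2) * (\<Sum>k\<le>min (Suc p) (Suc q). inv_coeff (Suc p) (Suc q) k) =
     (\<Sum>k\<le>min p (Suc q). inv_coeff p (Suc q) k) + (\<Sum>k\<le>min (Suc p) q. inv_coeff (Suc p) q k)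
      + (\<Sum>k\<le>min p q. inv_coeff p q k)"
proof -
  let ?m = "Suc (p + q)"
  have "(real p + real q + 2) * (\<Sum>k\<le>?m. inv_coeff (Suc p) (Suc q) k) =
      (\<Sum>k\<le>?m. (1 + real p - real k) * inv_coeff (Suc p) (Suc q) k +
         (1 + real q - real k) * inv_coeff (Suc q) (Suc p) k + 2 * real k * inv_coeff (Suc p) (Suc q) k)"
    unfolding sum_distrib_left
    by (intro sum.cong) (auto simp: inv_coeff_commute[of "Suc q"] algebra_simps)
  also have "\<dots> = (\<Sum>k\<le>?m. inv_coeff p (Suc q) k) + (\<Sum>k\<le>?m. inv_coeff (Suc p) q k)
      + (\<Sum>k\<le>?m. 2 * real k * inv_coeff (Suc p) (Suc q) k)"
    by (simp only: inv_coeff_Suc_left sum.distrib inv_coeff_commute[of q])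
  \<comment> \<open>The factor \<open>k\<close> removes the term at zero, so the index can be
    shifted down by one.\<close>
  also have "(\<Sum>k\<le>?m. 2 * real k * inv_coeff (Suc p) (Suc q) k) = (\<Sum>k\<le>p + q. inv_coeff p q k)"
    using inv_coeff_Suc_Suc by (subst sum.atMost_Suc_shift) simp
  finally show ?thesis
    using sum_inv_coeff[of "Suc p" "Suc q" ?m] sum_inv_coeff[of p "Suc q" ?m]
      sum_inv_coeff[of "Suc p" q ?m] sum_inv_coeff[of p q "p + q"]
    by simp
qed

text \<open>Strong induction on \<open>p + q\<close>, because deletion lowers the size by one or by
  two. The cases with \<open>p = 0\<close> or \<open>q = 0\<close> are separate, as the formula has
  no meaning for negative indices.\<close>

lemma card_weighted_involutions:
  assumes "finite A" "card A = p + q"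
  shows "real (card (weighted_involutions A (int p - int q))) = fact (p + q) * (\<Sum>k\<le>min p q. inv_coeff p q k)"
  using assms
proof (induction "p + q" arbitrary: A p q rule: less_induct)
  case less
  have IH: "real (card (weighted_involutions B (int a - int b))) = fact (a + b) * (\<Sum>k\<le>min a b. inv_coeff a b k)"
    if "a + b < p + q" "finite B" "card B = a + b" for B a b
    using less.hyps that by blast
  show ?case
  proof (cases "A = {}")
    case True
    then show ?thesis
      using less.prems by (simp add: weighted_involutions_empty inv_coeff_def)
  next
    case False
    then obtain x B where A: "A = insert x B" "x \<notin> B"
      by (metis all_not_in_conv mk_disjoint_insert)
    then have B: "finite B" "Suc (card B) = p + q"
      using less.prems by auto
    note ins = card_weighted_involutions_insert[OF B(1) A(2), folded A(1)]
    have cB: "card (B - {j}) < card B" if "j \<in> B" for j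
      using that B by (meson card_Diff1_less)
    consider "p = 0" "q > 0" | "p > 0" "q = 0" | p' q' where "p = Suc p'" "q = Suc q'"
      using B by (metis add_is_0 gr0_conv_Suc not_gr_zero nat.distinct(1))
    then show ?thesis
    proof cases
      case 1
      then obtain q' where q: "q = Suc q'" using gr0_conv_Suc by blast
      \<comment> \<open>Here \<open>card B = q - 1\<close>, so a plus point or a matched pair would
        leave too few points for the required excess.\<close>
      have "weighted_involutions B (- int q - 1) = {}" "\<And>j. j \<in> B \<Longrightarrow> weighted_involutions (B - {j}) (- int q) = {}"
        using B 1 cB by (force intro!: weighted_involutions_eq_empty)+
      then have "real (card (weighted_involutions A (int p - int q))) = real (card (weighted_involutions B (int 0 - int q')))"
        using ins[of "int p - int q"] 1 q by simp
      also have "\<dots> = 1"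
        using B 1 q by (subst IH) (auto simp: inv_coeff_def)
      finally show ?thesis
        using 1 by (simp add: inv_coeff_def)
    next
      case 2
      then obtain p' where p: "p = Suc p'" using gr0_conv_Suc by blast
      have "weighted_involutions B (int p + 1) = {}" "\<And>j. j \<in> B \<Longrightarrow> weighted_involutions (B - {j}) (int p) = {}"
        using B 2 cB by (force intro!: weighted_involutions_eq_empty)+
      then have "real (card (weighted_involutions A (int p - int q))) = real (card (weighted_involutions B (int p' - int 0)))"
        using ins[of "int p - int q"] 2 p by simp
      also have "\<dots> = 1"
        using B 2 p by (subst IH) (auto simp: inv_coeff_def)
      finally show ?thesis
        using 2 by (simp add: inv_coeff_def)
    next
      case 3
      let ?c = "\<lambda>a b. \<Sum>k\<le>min a b. inv_coeff a b k"
      have 1: "real (card (weighted_involutions B (int p' - int q))) = fact (p' + q) * ?c p' q"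
        using B 3 by (intro IH) auto
      have 2: "real (card (weighted_involutions B (int p - int q'))) = fact (p + q') * ?c p q'"
        using B 3 by (intro IH) auto
      have s: "real (card (weighted_involutions (B - {j}) (int p' - int q'))) = fact (p' + q') * ?c p' q'"
        if "j \<in> B" for j
        using B 3 that by (intro IH) auto
      have d: "int p - int q - 1 = int p' - int q" "int p - int q + 1 = int p - int q'" "int p - int q = int p' - int q'"
        using 3 by auto
      have "real (card (weighted_involutions A (int p - int q))) =
          fact (p' + q) * ?c p' q + fact (p + q') * ?c p q' + real (card B) * (fact (p' + q') * ?c p' q')"
        unfolding ins of_nat_add of_nat_sum d(1,2) 1 2 unfolding d(3) using s by simp
      \<comment> \<open>Both \<open>p' + q\<close> and \<open>p + q'\<close> equal
        \<open>card B\<close>, and \<open>card B\<close> times the factorial of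
        \<open>p' + q'\<close> is the factorial of \<open>card B\<close>.\<close>
      also have "\<dots> = fact (Suc (p' + q')) * (?c p' q + ?c p q' + ?c p' q')"
      proof -
        have "card B = Suc (p' + q')" using B 3 by simp
        then show ?thesis using 3 by (simp add: algebra_simps)
      qed
      also have "\<dots> = fact (p + q) * ?c p q"
      proof -
        have "(fact (p + q) :: real) = fact (Suc (p' + q')) * (real p' + real q' + 2)"
          using 3 by (simp add: algebra_simps)
        then show ?thesis
          unfolding 3 by (simp only: mult.assoc sum_inv_coeff_Suc)
      qed
      finally show ?thesis .
    qed
  qed
qed

lemma alpha_eq: "real (alpha p q) = fact (p + q) * (\<Sum>k\<le>min p q. inv_coeff p q k)"
  unfolding alpha_def signed_involutions_eq by (rule card_weighted_involutions) auto

subsection \<open>Binomial generating functions\<close>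

text \<open>The binomial series with exponent \<open>- (N + 1)\<close> at \<open>- x\<close>; the
  sign of the generalized binomial coefficient cancels against that of \<open>- x\<close>.\<close>

lemma sums_negative_binomial:
  fixes x :: complex
  assumes "norm x < 1"
  shows "(\<lambda>b. of_nat ((N + b) choose b) * x ^ b) sums (1 / (1 - x) ^ Suc N)"
proof -
  have "(\<lambda>b. ((- of_nat (Suc N)) gchoose b) * (- x) ^ b) sums (1 + (- x)) powr (- of_nat (Suc N))"
    using assms by (intro gen_binomial_complex) simp
  moreover have "((- of_nat (Suc N)) gchoose b) * (- x) ^ b = of_nat ((N + b) choose b) * x ^ b" for b
  proof -
    have "(- of_nat (Suc N)) gchoose b = (- 1) ^ b * (of_nat (N + b) gchoose b :: complex)"
      by (subst gbinomial_minus) simp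
    then show ?thesis
      by (simp add: binomial_gbinomial power_minus[of x] flip: of_nat_add)
  qed
  moreover have "(1 + (- x)) powr (- of_nat (Suc N)) = 1 / (1 - x) ^ Suc N"
    using powr_nat'[of "1 - x" "Suc N"]
    by (simp only: powr_minus add_uminus_conv_diff divide_inverse mult_1_left) simp
  ultimately show ?thesis by simp
qed

lemma has_sum_negative_binomial:
  fixes x :: complex
  assumes "norm x < 1"
  shows "((\<lambda>b. of_nat ((N + b) choose b) * x ^ b) has_sum (1 / (1 - x) ^ Suc N)) UNIV"
proof (rule norm_summable_imp_has_sum[OF _ sums_negative_binomial[OF assms]])
  \<comment> \<open>A real point strictly between \<open>norm x\<close> and 1: convergence there
    gives absolute convergence at \<open>x\<close>.\<close>
  define c where "c = (1 + norm x) / 2"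
  have c: "norm x < c" "c < 1" "0 \<le> c" using assms by (auto simp: c_def)
  then have "summable (\<lambda>b. of_nat ((N + b) choose b) * complex_of_real c ^ b)"
    using sums_negative_binomial[of "of_real c" N] by (simp add: sums_iff)
  then show "summable (\<lambda>b. norm (of_nat ((N + b) choose b) * x ^ b))"
    by (rule powser_insidea) (use c in auto)
qed

section \<open>The binomials \<open>a + 2 * k\<close> choose \<open>k\<close>\<close>

lemma norm_binomial_term_le:
  fixes w :: complex
  assumes "norm w \<le> 1/8"
  shows "norm (of_nat ((a + 2 * k) choose k) * w ^ k) \<le> 2 ^ a * (1/2) ^ k"
proof -
  \<comment> \<open>A binomial is at most two to its upper index, and the radius 1/8 beats the
    growth \<open>4 ^ k\<close> by a factor of two per term.\<close>
  have "norm (of_nat ((a + 2 * k) choose k) * w ^ k) \<le> 2 ^ (a + 2 * k) * (1/8) ^ k"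
    unfolding norm_mult norm_power norm_of_nat
    using of_nat_mono[OF binomial_le_pow2[of "a + 2 * k" k], where 'a = real] assms
    by (intro mult_mono power_mono) simp_all
  also have "\<dots> = 2 ^ a * (1/2) ^ k"
    by (simp add: power_add power_mult mult.assoc flip: power_mult_distrib)
  finally show ?thesis .
qed

lemma summable_norm_binomial:
  fixes w :: complex
  assumes "norm w \<le> 1/8"
  shows "summable (\<lambda>k. norm (of_nat ((a + 2 * k) choose k) * w ^ k))"
proof (rule summable_comparison_test')
  show "summable (\<lambda>k. 2 ^ a * (1/2) ^ k :: real)"
    by (intro summable_mult summable_geometric) simp
  show "norm (norm (of_nat ((a + 2 * k) choose k) * w ^ k)) \<le> 2 ^ a * (1/2) ^ k" for k
    using norm_binomial_term_le[OF assms] by simp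
qed

text \<open>For small \<open>w\<close> this is \<open>C ^ a / sqrt (1 - 4 * w)\<close>, with
  \<open>C\<close> the generating function of the Catalan numbers.\<close>

definition binomial_gf :: "complex \<Rightarrow> nat \<Rightarrow> complex" where
  "binomial_gf w a = (\<Sum>k. of_nat ((a + 2 * k) choose k) * w ^ k)"

lemma norm_binomial_gf_le:
  assumes "norm w \<le> 1/8"
  shows "norm (binomial_gf w a) \<le> 2 * 2 ^ a"
proof -
  have "(\<lambda>k. 2 ^ a * (1/2) ^ k) sums (2 ^ a * (1 / (1 - 1/2)) :: real)"
    by (intro sums_mult geometric_sums) auto
  then have "norm (binomial_gf w a) \<le> 2 ^ a * (1 / (1 - 1/2))"
    unfolding binomial_gf_def
    using norm_binomial_term_le[OF assms, of a]
    by (metis (no_types, lifting) norm_suminf_le sums_summable sums_unique)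
  then show ?thesis by simp
qed

text \<open>Pascal's rule applied to each coefficient; the part with the lower index reduced becomes
  the series for \<open>a + 2\<close>, shifted by one power of \<open>w\<close>.\<close>

lemma binomial_gf_Suc:
  assumes "norm w \<le> 1/8"
  shows "binomial_gf w (Suc a) = binomial_gf w a + w * binomial_gf w (Suc (Suc a))"
proof -
  note sm = summable_norm_cancel[OF summable_norm_binomial[OF assms]]
  let ?t = "\<lambda>a k. of_nat ((a + 2 * k) choose k) * w ^ k"
  have "binomial_gf w (Suc a) = 1 + (\<Sum>k. ?t (Suc a) (Suc k))"
    unfolding binomial_gf_def using suminf_split_head[OF sm[of "Suc a"]] by simp
  also have "(\<lambda>k. ?t (Suc a) (Suc k)) = (\<lambda>k. ?t a (Suc k) + w * ?t (Suc (Suc a)) k)"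
    by (auto simp: algebra_simps)
  also have "(\<Sum>k. ?t a (Suc k) + w * ?t (Suc (Suc a)) k) =
      (\<Sum>k. ?t a (Suc k)) + (\<Sum>k. w * ?t (Suc (Suc a)) k)"
  proof (rule suminf_add[symmetric])
    show "summable (\<lambda>k. ?t a (Suc k))"
      using sm[of a] by (subst summable_Suc_iff)
    show "summable (\<lambda>k. w * ?t (Suc (Suc a)) k)"
      using sm[of "Suc (Suc a)"] by (rule summable_mult)
  qed
  also have "(\<Sum>k. w * ?t (Suc (Suc a)) k) = w * binomial_gf w (Suc (Suc a))"
    unfolding binomial_gf_def by (rule suminf_mult[OF sm])
  also have "1 + ((\<Sum>k. ?t a (Suc k)) + w * binomial_gf w (Suc (Suc a))) =
      binomial_gf w a + w * binomial_gf w (Suc (Suc a))"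
    unfolding binomial_gf_def by (subst suminf_split_head[OF sm[of a]]) simp
  finally show ?thesis .
qed

text \<open>By symmetry a central binomial is twice its left parent in Pascal's triangle. This is
  the boundary equation where the recurrence would reach a negative index.\<close>

lemma binomial_gf_0:
  assumes "norm w \<le> 1/8"
  shows "binomial_gf w 0 = 1 + 2 * w * binomial_gf w 1"
proof -
  note sm = summable_norm_cancel[OF summable_norm_binomial[OF assms]]
  let ?t = "\<lambda>a k. of_nat ((a + 2 * k) choose k) * w ^ k"
  have "binomial_gf w 0 = 1 + (\<Sum>k. ?t 0 (Suc k))"
    unfolding binomial_gf_def using suminf_split_head[OF sm[of 0]] by simp
  also have "(\<lambda>k. ?t 0 (Suc k)) = (\<lambda>k. 2 * w * ?t 1 k)"
  proof
    fix k
    have "Suc (Suc (2 * k)) choose Suc k = 2 * (Suc (2 * k) choose k)"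
      using binomial_symmetric[of k "Suc (2 * k)"] by simp
    then show "?t 0 (Suc k) = 2 * w * ?t 1 k" by simp
  qed
  also have "(\<Sum>k. 2 * w * ?t 1 k) = 2 * w * binomial_gf w 1"
    unfolding binomial_gf_def by (rule suminf_mult[OF sm])
  finally show ?thesis .
qed

text \<open>
  The error \<open>D\<close> solves the homogeneous recurrence and grows at most like \<open>2^a\<close>. For small \<open>w\<close> the
  recurrence shrinks the constant in such a bound by the factor \<open>3/4\<close>, so \<open>D\<close> vanishes.
  This avoids choosing a branch of \<open>sqrt (1 - 4w)\<close>.
\<close>

lemma binomial_gf_eq:
  assumes "norm z \<le> 1/16"
  shows "binomial_gf (z * (1 - z)) a = 1 / ((1 - z) ^ a * (1 - 2 * z))"
proof -
  define w where "w = z * (1 - z)"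
  have "norm (1 - z) \<le> 2" "norm (1 - z) \<ge> 1/2" "norm (1 - 2 * z) \<ge> 1/2"
    using assms norm_triangle_ineq4[of 1 z] norm_triangle_ineq2[of 1 z] norm_triangle_ineq2[of 1 "2 * z"]
    by auto
  note z = this
  have nz: "1 - z \<noteq> 0" "1 - 2 * z \<noteq> 0" using z by auto
  have "norm z * norm (1 - z) \<le> 1/16 * 2"
    using assms z by (intro mult_mono) auto
  then have w: "norm w \<le> 1/8" by (simp add: w_def norm_mult)
  define T where "T a = 1 / ((1 - z) ^ a * (1 - 2 * z))" for a
  define D where "D a = binomial_gf w a - T a" for a
  have T0: "T 0 = 1 + 2 * w * T 1" and TS: "T (Suc a) = T a + w * T (Suc (Suc a))" for a
    using nz unfolding T_def w_def by (auto simp: divide_simps)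
  have D0: "D 0 = 2 * w * D 1" and DS: "D (Suc a) = D a + w * D (Suc (Suc a))" for a
    unfolding D_def using T0 TS[of a] binomial_gf_0[OF w] binomial_gf_Suc[OF w, of a]
    by (auto simp: algebra_simps)
  have T: "norm (T a) \<le> 2 * 2 ^ a" for a
  proof -
    have "(1/2) ^ a * (1/2) \<le> norm (1 - z) ^ a * norm (1 - 2 * z)"
      using z by (intro mult_mono power_mono) auto
    then have "1 / (norm (1 - z) ^ a * norm (1 - 2 * z)) \<le> 1 / ((1/2) ^ a * (1/2))"
      by (intro divide_left_mono mult_pos_pos) (use nz in auto)
    then show ?thesis by (simp add: T_def norm_divide norm_mult norm_power power_divide)
  qed
  have "norm (D a) \<le> 4 * (3/4) ^ n * 2 ^ a" for a n
  proof (induction n arbitrary: a)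
    case 0
    show ?case
      using norm_triangle_ineq4[of "binomial_gf w a" "T a"] norm_binomial_gf_le[OF w, of a] T[of a]
      by (simp add: D_def)
  next
    case (Suc n)
    show ?case
    proof (cases a)
      case 0
      \<comment> \<open>The boundary equation gains \<open>2 * (1/8) * 2 = 1/2\<close>, which is
        below 3/4.\<close>
      have "norm (D 0) = 2 * norm w * norm (D 1)"
        by (subst D0) (simp add: norm_mult)
      also have "\<dots> \<le> 2 * (1/8) * (4 * (3/4) ^ n * 2 ^ 1)"
        using w Suc[of 1] by (intro mult_mono) auto
      also have "\<dots> \<le> 4 * (3/4) ^ Suc n * 2 ^ 0"
        by simp
      finally show ?thesis using 0 by simp
    next
      case (Suc b)
      have "norm (D (Suc b)) \<le> norm (D b) + norm w * norm (D (Suc (Suc b)))"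
        by (subst DS) (metis norm_mult norm_triangle_ineq)
      \<comment> \<open>Relative to \<open>2 ^ Suc b\<close> the two terms weigh 1/2 and
        \<open>1/8 * 2\<close>, adding up to 3/4.\<close>
      also have "\<dots> \<le> 4 * (3/4) ^ n * 2 ^ b + 1/8 * (4 * (3/4) ^ n * 2 ^ Suc (Suc b))"
        using w Suc.IH[of b] Suc.IH[of "Suc (Suc b)"] by (intro add_mono mult_mono) auto
      also have "\<dots> = 4 * (3/4) ^ Suc n * 2 ^ Suc b"
        by (simp add: field_simps)
      finally show ?thesis using Suc by simp
    qed
  qed
  moreover have "(\<lambda>n. 4 * (3/4) ^ n * 2 ^ a) \<longlonglongrightarrow> (4 * 0 * 2 ^ a :: real)"
    by (intro tendsto_intros LIMSEQ_power_zero) auto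
  ultimately have "norm (D a) \<le> 0"
    by (metis (no_types, lifting) LIMSEQ_le_const mult_zero_left mult_zero_right)
  then show ?thesis by (simp add: D_def T_def w_def)
qed

lemma has_sum_binomial_gf:
  fixes z :: complex
  assumes "norm z \<le> 1/16"
  shows "((\<lambda>k. of_nat ((a + 2 * k) choose k) * (z * (1 - z)) ^ k) has_sum
           (1 / ((1 - z) ^ a * (1 - 2 * z)))) UNIV"
proof (rule norm_summable_imp_has_sum)
  have "norm z * norm (1 - z) \<le> 1/16 * 2"
    using assms norm_triangle_ineq4[of 1 z] by (intro mult_mono) auto
  then have "norm (z * (1 - z)) \<le> 1/8" by (simp add: norm_mult)
  note s = summable_norm_binomial[OF this, of a]
  show "summable (\<lambda>k. norm (of_nat ((a + 2 * k) choose k) * (z * (1 - z)) ^ k))" by (rule s)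
  show "(\<lambda>k. of_nat ((a + 2 * k) choose k) * (z * (1 - z)) ^ k) sums (1 / ((1 - z) ^ a * (1 - 2 * z)))"
    using summable_sums[OF summable_norm_cancel[OF s]] binomial_gf_eq[OF assms, of a]
    by (simp add: binomial_gf_def)
qed

subsection \<open>Summation of the double series\<close>

lemma summable_on_product:
  fixes f :: "'a \<Rightarrow> real" and g :: "'b \<Rightarrow> real"
  assumes "f summable_on A" "g summable_on B" "\<And>x. f x \<ge> 0" "\<And>y. g y \<ge> 0"
  shows "(\<lambda>(x, y). f x * g y) summable_on A \<times> B"
proof (rule summable_on_SigmaI)
  show "((\<lambda>y. case (x, y) of (x, y) \<Rightarrow> f x * g y) has_sum f x * infsum g B) B" for x
    using has_sum_cmult_right[OF has_sum_infsum[OF assms(2)], of "f x"] by simp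
  show "(\<lambda>x. f x * infsum g B) summable_on A"
    using assms(1) by (rule summable_on_cmult_left)
qed (use assms in auto)

lemma summable_on_geometric:
  fixes c :: real
  assumes "0 \<le> c" "c < 1"
  shows "(\<lambda>n. c ^ n) summable_on UNIV"
  using assms norm_summable_imp_summable_on[of "\<lambda>n. c ^ n"] by (simp add: summable_geometric)

text \<open>The nesting of the index lets \<open>b\<close>, then \<open>k\<close>, be summed out
  from the right. The binomials are arranged so that each inner sum is a known series.\<close>

definition triple_term :: "complex \<Rightarrow> complex \<Rightarrow> (nat \<times> nat) \<times> nat \<Rightarrow> complex" where
  "triple_term x y = (\<lambda>((a, k), b). of_nat ((a + 2 * k + b) choose b) * x ^ b *
     (of_nat ((a + 2 * k) choose k) / fact a * y ^ a * (x * y / 2) ^ k))"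

lemma summable_triple_term:
  assumes "norm x \<le> 1/8" "norm y \<le> 1/8"
  shows "triple_term x y summable_on UNIV"
proof -
  \<comment> \<open>Bounding both binomials by powers of two leaves the ratios
    \<open>2 * 2 / 8\<close> for \<open>a\<close>, \<open>4 * 4 / 128\<close> for \<open>k\<close>
    and \<open>2 / 8\<close> for \<open>b\<close>.\<close>
  define g :: "(nat \<times> nat) \<times> nat \<Rightarrow> real"
    where "g = (\<lambda>(ak, b). (case ak of (a, k) \<Rightarrow> (1/2) ^ a * (1/8) ^ k) * (1/4) ^ b)"
  have "g summable_on UNIV \<times> UNIV"
    unfolding g_def UNIV_Times_UNIV[symmetric]
    by (intro summable_on_product summable_on_geometric) (auto split: prod.splits)
  moreover have "norm (triple_term x y t) \<le> g t" for t
  proof -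
    obtain a k b where t: "t = ((a, k), b)" by (metis surj_pair)
    define w where "w = x * y / 2"
    have w: "norm w \<le> 1/128"
      using mult_mono[OF assms] by (simp add: w_def norm_mult norm_divide)
    have B: "real (n choose m) \<le> 2 ^ n" for n m
      using of_nat_mono[OF binomial_le_pow2[of n m], where 'a = real] by simp
    have C: "real ((a + 2 * k) choose k) / fact a \<le> 2 ^ (a + 2 * k)"
      using frac_le[OF _ B[of "a + 2 * k" k], of 1 "fact a"] fact_ge_1[of a, where 'a = real] by simp
    have "norm (triple_term x y t) = real ((a + 2 * k + b) choose b) * norm x ^ b *
        (real ((a + 2 * k) choose k) / fact a * norm y ^ a * norm w ^ k)"
      unfolding t triple_term_def prod.case w_def[symmetric]
      by (simp only: norm_mult norm_divide norm_power norm_of_nat norm_fact)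
    also have "\<dots> \<le> 2 ^ (a + 2 * k + b) * (1/8) ^ b * (2 ^ (a + 2 * k) * (1/8) ^ a * (1/128) ^ k)"
      by (intro mult_mono power_mono B C w assms) simp_all
    also have "\<dots> = (2 * 2 * (1/8)) ^ a * (2\<^sup>2 * 2\<^sup>2 * (1/128)) ^ k * (2 * (1/8)) ^ b"
      unfolding power_add power_mult_distrib power_mult by (simp only: mult_ac)
    also have "\<dots> = g t"
      by (simp add: t g_def)
    finally show ?thesis .
  qed
  ultimately have "(\<lambda>t. norm (triple_term x y t)) summable_on UNIV"
    using Infinite_Sum.abs_summable_on_comparison_test'[of g UNIV "triple_term x y"] by simp
  then show ?thesis by (rule abs_summable_summable)
qed

section \<open>Passing from the triple series to the double series\<close>

lemma triple_term_eq:
  "triple_term x y ((a, k), b) =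
     fact (a + k + (b + k)) * of_real (inv_coeff (a + k) (b + k) k) * x ^ (b + k) * (y ^ (a + k) / fact (a + k))"
proof -
  have "(of_nat ((a + 2 * k + b) choose b) :: complex) = fact (a + 2 * k + b) / (fact b * fact (a + 2 * k))"
    by (subst binomial_fact) auto
  moreover have "(of_nat ((a + 2 * k) choose k) :: complex) = fact (a + 2 * k) / (fact k * fact (a + k))"
    by (subst binomial_fact) (auto simp: mult_2)
  moreover have "(fact (a + k + (b + k)) :: complex) = fact (a + 2 * k + b)"
    by (simp add: mult_2 add_ac)
  ultimately show ?thesis
    unfolding triple_term_def prod.case
    by (simp add: inv_coeff_def power_add power_mult_distrib power_divide mult_ac del: of_nat_add)
qed

text \<open>The triples \<open>(a, k, b)\<close> correspond to the triples \<open>(p, q, k)\<close>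
  with \<open>k \<le> min p q\<close>; for fixed \<open>p\<close> and \<open>q\<close> the finite
  sum over \<open>k\<close> is the formula for \<open>alpha\<close>.\<close>

lemma has_sum_v_term:
  assumes "(triple_term x y has_sum V) UNIV"
  shows "(v_term x y has_sum V) UNIV"
proof -
  let ?f = "\<lambda>((p, q), k). fact (p + q) * of_real (inv_coeff p q k) * x ^ q * (y ^ p / fact p)"
  have "(?f has_sum V) (SIGMA (p, q):UNIV. {..min p q}) \<longleftrightarrow> (triple_term x y has_sum V) UNIV"
    by (rule has_sum_reindex_bij_witness[of _ "\<lambda>((a, k), b). ((a + k, b + k), k)" "\<lambda>((p, q), k). ((p - k, k), q - k)"])
      (auto simp: triple_term_eq)
  then have "(?f has_sum V) (SIGMA (p, q):UNIV. {..min p q})"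
    using assms by blast
  then show ?thesis
  proof (rule has_sum_SigmaD)
    fix pq :: "nat \<times> nat"
    obtain p q where pq: "pq = (p, q)" by (metis surj_pair)
    have "(of_nat (alpha p q) :: complex) = of_real (real (alpha p q))"
      by simp
    also have "\<dots> = (\<Sum>k\<le>min p q. fact (p + q) * of_real (inv_coeff p q k))"
      unfolding alpha_eq by (simp add: sum_distrib_left)
    finally have "v_term x y pq = (\<Sum>k\<le>min p q. ?f (pq, k))"
      unfolding v_term_def pq prod.case by (simp only: sum_distrib_right)
    then show "((\<lambda>k. ?f (pq, k)) has_sum v_term x y pq) (case pq of (p, q) \<Rightarrow> {..min p q})"
      unfolding pq prod.case by (intro has_sum_finiteI) auto
  qed
qed

lemma has_sum_exp:
  fixes z :: complex
  shows "((\<lambda>n. z ^ n / fact n) has_sum exp z) UNIV"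
proof (rule norm_summable_imp_has_sum)
  show "summable (\<lambda>n. norm (z ^ n / fact n))"
    using summable_norm_exp[of z] by (simp add: divide_inverse mult.commute scaleR_conv_of_real norm_mult norm_inverse)
  show "(\<lambda>n. z ^ n / fact n) sums exp z"
    using exp_converges[of z] by (simp add: divide_inverse mult.commute scaleR_conv_of_real)
qed

text \<open>The unconditional sum of the triple series is evaluated one index at a time. Smallness
  of \<open>z\<close> selects the root of the quadratic to which the binomial generating function
  applies.\<close>

lemma has_sum_v_term_closed_form:
  assumes x: "norm x \<le> 1/8" and y: "norm y \<le> 1/8" and z: "norm z \<le> 1/16"
    and w: "z * (1 - z) = x * y / (2 * (1 - x)\<^sup>2)"
  shows "(v_term x y has_sum exp (y / ((1 - x) * (1 - z))) / ((1 - x) * (1 - 2 * z))) UNIV"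
proof -
  have x1: "1 - x \<noteq> 0" using x by auto
  obtain V where V: "(triple_term x y has_sum V) UNIV"
    using summable_triple_term[OF x y] by (auto simp: summable_on_def)
  let ?g = "\<lambda>(a, k). 1 / (1 - x) ^ Suc (a + 2 * k) * (of_nat ((a + 2 * k) choose k) / fact a * y ^ a * (x * y / 2) ^ k)"
  let ?h = "\<lambda>a. (y / (1 - x)) ^ a / fact a / (1 - x) * (1 / ((1 - z) ^ a * (1 - 2 * z)))"
  have "(triple_term x y has_sum V) (UNIV \<times> UNIV)" using V by simp
  then have "(?g has_sum V) UNIV"
  proof (rule has_sum_SigmaD)
    fix ak :: "nat \<times> nat"
    obtain a k where ak: "ak = (a, k)" by (metis surj_pair)
    show "((\<lambda>b. triple_term x y (ak, b)) has_sum ?g ak) UNIV"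
      unfolding ak triple_term_def prod.case
      by (intro has_sum_cmult_left has_sum_negative_binomial) (use x in auto)
  qed
  then have "(?g has_sum V) (UNIV \<times> UNIV)" by simp
  then have "(?h has_sum V) UNIV"
  proof (rule has_sum_SigmaD)
    \<comment> \<open>The factor \<open>(1 - x) ^ (2 * k)\<close> left by the sum over
      \<open>b\<close> merges with \<open>(x * y / 2) ^ k\<close> into the power of
      \<open>z * (1 - z)\<close>.\<close>
    fix a :: nat
    have g: "?g (a, k) = (y / (1 - x)) ^ a / fact a / (1 - x) * (of_nat ((a + 2 * k) choose k) * (z * (1 - z)) ^ k)" for k
      unfolding w using x1
      by (simp add: power_add power_divide power_mult_distrib power_mult[symmetric] field_simps)
    show "((\<lambda>k. ?g (a, k)) has_sum ?h a) UNIV"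
      unfolding g by (intro has_sum_cmult_right has_sum_binomial_gf z)
  qed
  moreover have "((\<lambda>a. (y / ((1 - x) * (1 - z))) ^ a / fact a * (1 / ((1 - x) * (1 - 2 * z)))) has_sum
      exp (y / ((1 - x) * (1 - z))) * (1 / ((1 - x) * (1 - 2 * z)))) UNIV"
    by (intro has_sum_cmult_left has_sum_exp)
  moreover have "?h = (\<lambda>a. (y / ((1 - x) * (1 - z))) ^ a / fact a * (1 / ((1 - x) * (1 - 2 * z))))"
    by (simp add: fun_eq_iff power_divide power_mult_distrib)
  ultimately have "V = exp (y / ((1 - x) * (1 - z))) / ((1 - x) * (1 - 2 * z))"
    using has_sum_unique by fastforce
  then show ?thesis
    using has_sum_v_term[OF V] by simp
qed

section \<open>Convergence near the origin and the rational change of variables\<close>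

theorem theorem5p1:
  shows "eventually (\<lambda>(x, y). v_term x y summable_on UNIV) (nhds (0, 0)) \<and>
    eventually (\<lambda>(r, s). v (x_coord r s) (y_coord r s) = exp s * (r * s + 1) / (1 - r))
      (nhds (0, 0))"
proof
  have ev: "eventually (\<lambda>t. norm (f t) < e) (nhds (0, 0))"
    if "isCont f (0, 0)" "f (0, 0) = 0" "e > 0" for f :: "complex \<times> complex \<Rightarrow> complex" and e :: real
  proof -
    have "(f \<longlongrightarrow> 0) (nhds (0, 0))"
      using that by (metis isCont_def tendsto_at_iff_tendsto_nhds)
    then show ?thesis
      using that(3) by (auto simp: tendsto_iff dist_norm)
  qed
  have "eventually (\<lambda>t :: complex \<times> complex. norm (fst t) < 1/8 \<and> norm (snd t) < 1/8) (nhds (0, 0))"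
    by (intro eventually_conj ev) (auto intro!: continuous_intros)
  then show "eventually (\<lambda>(x, y). v_term x y summable_on UNIV) (nhds (0, 0))"
  proof eventually_elim
    case (elim t)
    then have "triple_term (fst t) (snd t) summable_on UNIV"
      by (intro summable_triple_term) auto
    then have "v_term (fst t) (snd t) summable_on UNIV"
      unfolding summable_on_def using has_sum_v_term by blast
    then show ?case
      by (simp add: case_prod_beta)
  qed
  define Z where "Z r s = r * s / (2 * (1 + r * s - r))" for r s :: complex
  have "eventually (\<lambda>t. norm (x_coord (fst t) (snd t)) < 1/8 \<and> norm (y_coord (fst t) (snd t)) < 1/8 \<and>
      norm (Z (fst t) (snd t)) < 1/16 \<and> norm (fst t) < 1/8 \<and> norm (snd t) < 1/8) (nhds (0, 0))"
    unfolding x_coord_def y_coord_def Z_def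
    by (intro eventually_conj ev) (auto intro!: continuous_intros)
  then show "eventually (\<lambda>(r, s). v (x_coord r s) (y_coord r s) = exp s * (r * s + 1) / (1 - r)) (nhds (0, 0))"
  proof eventually_elim
    case (elim t)
    obtain r s where t: "t = (r, s)" by (metis surj_pair)
    define x y z where "x = x_coord r s" "y = y_coord r s" "z = Z r s"
    note xyz = this[unfolded x_coord_def y_coord_def Z_def]
    have b: "norm x < 1/8" "norm y < 1/8" "norm z < 1/16" "norm r < 1/8" "norm s < 1/8"
      using elim by (auto simp: t x_y_z_def)
    have "norm r * norm s \<le> 1/8 * (1/8)" using b by (intro mult_mono) auto
    then have "norm (r * s) \<le> 1/64" by (simp add: norm_mult)
    then have nz: "r * s + 1 \<noteq> 0" "1 - r \<noteq> 0" "1 - z \<noteq> 0"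
      using b by (auto simp: add_eq_0_iff2)
    define u where "u = 1 + r * s - r"
    have u: "u \<noteq> 0"
    proof
      assume "u = 0"
      moreover have "r - r * s = 1 - u" by (simp add: u_def)
      ultimately have "norm (r - r * s) = 1" by simp
      then show False
        using norm_triangle_ineq4[of r "r * s"] b \<open>norm (r * s) \<le> 1/64\<close> by linarith
    qed
    \<comment> \<open>With these abbreviations \<open>x\<close>, \<open>y\<close>,
      \<open>1 - x\<close> and \<open>1 - z\<close> are all short fractions, and \<open>n\<close>,
      \<open>u\<close> and \<open>q\<close> cancel from the exponent, leaving exactly
      \<open>s\<close>.\<close>
    define q n where "q = r * s + 1" and "n = 2 + r * s - 2 * r"
    have q: "q \<noteq> 0" using nz by (simp add: q_def)
    have x: "x = r / q" and z: "z = r * s / (2 * u)"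
      unfolding xyz u_def q_def by simp_all
    have y: "y = s * n / (2 * q)"
      unfolding xyz q_def n_def by (simp add: algebra_simps power2_eq_square)
    have x1: "1 - x = u / q"
      unfolding x using q by (simp add: divide_simps) (simp add: u_def q_def)
    have z1: "1 - z = n / (2 * u)" and z2: "1 - 2 * z = (1 - r) / u"
      unfolding z using u by (simp_all add: divide_simps) (simp_all add: u_def n_def algebra_simps)
    have n: "n \<noteq> 0" using nz(3) z1 by auto
    have "z * (1 - z) = x * y / (2 * (1 - x)\<^sup>2)"
      unfolding x1 z1 unfolding x y z using q u by (simp add: field_simps power2_eq_square)
    then have "(v_term x y has_sum exp (y / ((1 - x) * (1 - z))) / ((1 - x) * (1 - 2 * z))) UNIV"
      using b by (intro has_sum_v_term_closed_form) auto
    moreover have "y / ((1 - x) * (1 - z)) = s"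
      unfolding x1 z1 y using q u n by (simp add: field_simps)
    moreover have "(1 - x) * (1 - 2 * z) = (1 - r) / q"
      unfolding x1 z2 using u by simp
    ultimately have "v x y = exp s * (r * s + 1) / (1 - r)"
      unfolding v_def by (simp add: infsumI q_def)
    then show ?case by (simp add: t x_y_z_def)
  qed
qed

end
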